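(* Let $n, m, \ell \ge 1$ be integers, let $\Omega \subseteq \mathbb{R}^n$ be a nonempty open set, let $s \in (0,1)$ and $p \in [1, +\infty)$. If $sp = 1$ and if the function $f : \mathbb{R}^m \to \mathbb{R}^\ell$ is Lipschitz-continuous and is not injective, then there exists a sequence $(u_j)_{j \in \mathbb{N}}$ in $\dot{W}^{s,p}(\Omega, \mathbb{R}^m)$ such that $$ \lim_{j \to \infty} \iint_{\Omega \times \Omega} \frac{|u_j(y) - u_j(x)|^p}{|y - x|^{n + sp}} \, \mathrm{d}y \, \mathrm{d}x = +\infty $$ and $$ \sup_{j \in \mathbb{N}} \iint_{\Omega \times \Omega} \frac{|f(u_j(y)) - f(u_j(x))|^p}{|y - x|^{n + sp}} \, \mathrm{d}y \, \mathrm{d}x < +\infty. $$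
   Context: For $\Omega \subseteq \mathbb{R}^n$, $0 < s < 1$ and $1 \le p < +\infty$, the homogeneous fractional Sobolev space $\dot{W}^{s,p}(\Omega, \mathbb{R}^m)$ is the set of (measurable) functions $v : \Omega \to \mathbb{R}^m$ such that $$\iint_{\Omega \times \Omega} \frac{|v(y) - v(x)|^p}{|y - x|^{n + sp}} \, \mathrm{d}y \, \mathrm{d}x < +\infty.$$ *)

theory Defs
  imports "HOL-Analysis.Analysis"
begin

text \<open>
  The integral is taken over \<open>\<Omega> \<times> \<Omega>\<close> with respect to the Lebesgue measure of the product space.
  On the diagonal the quotient is \<open>0 / 0 = 0\<close>; the diagonal is a null set.
\<close>

definition gagliardo_energy ::
  "real \<Rightarrow> real \<Rightarrow> 'a::euclidean_space set \<Rightarrow> ('a \<Rightarrow> 'b::euclidean_space) \<Rightarrow> ennreal" where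
  "gagliardo_energy s p \<Omega> v =
     (\<integral>\<^sup>+ z \<in> \<Omega> \<times> \<Omega>.
        (case z of (x, y) \<Rightarrow>
           ennreal (norm (v y - v x) powr p / norm (y - x) powr (real DIM('a) + s * p)))
      \<partial>lebesgue)"

text \<open>
  Elements are total functions, of which only the restriction to \<open>\<Omega>\<close> matters. They are
  Lebesgue measurable functions, not equivalence classes modulo null sets.
\<close>

definition hom_frac_sobolev ::
  "real \<Rightarrow> real \<Rightarrow> 'a::euclidean_space set \<Rightarrow> ('a \<Rightarrow> 'b::euclidean_space) set" where
  "hom_frac_sobolev s p \<Omega> =
     {v \<in> borel_measurable (lebesgue_on \<Omega>). gagliardo_energy s p \<Omega> v < \<infinity>}"

end

theory Submission
  imports Defs
begin

text \<open>
  Pick \<open>a \<noteq> b\<close> with \<open>f a = f b\<close>, and let \<open>u\<^sub>j\<close> move from \<open>b\<close> inside a sphere of radius \<open>R\<close> to \<open>a\<close> outside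
  it, affinely across a layer of thickness \<open>\<delta>\<^sub>j = R / 2\<^sup>j\<^sup>+\<^sup>1\<close>. The claim rests on the criticality
  of \<open>s p = 1\<close>: a Sobolev map of that regularity cannot jump across a hypersurface, but it only
  just fails to, so that the price of the transition is logarithmic in \<open>1 / \<delta>\<^sub>j\<close>.

  The composition \<open>f \<circ> u\<^sub>j\<close> takes the same value on both sides of the layer. Only pairs with a point
  in the layer contribute to its energy, and for such a point the inner integral is at most
  a multiple of \<open>1 / \<delta>\<^sub>j\<close>, because the integrand is cut off at \<open>|y - x| \<approx> \<delta>\<^sub>j\<close> by the Lipschitz bound;
  this uses \<open>p > 1\<close>, which follows from \<open>s p = 1\<close> and \<open>s < 1\<close>. The layer has volume of order
  \<open>\<delta>\<^sub>j\<close>, so the energies stay bounded (\<open>gagliardo_energy_le_transition_layer\<close>). The same lemma,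
  with the whole ball as layer, shows that each \<open>u\<^sub>j\<close> has finite energy.

  The maps \<open>u\<^sub>j\<close> themselves take different values on the two sides. At each dyadic scale
  \<open>r\<close> with \<open>\<delta>\<^sub>j \<lesssim> r \<lesssim> R\<close>, the pairs at distance about \<open>r\<close> on opposite sides of the sphere fill
  a set of measure about \<open>r \<cdot> r\<^sup>n\<close> on which the kernel is about \<open>1 / r\<^sup>n\<^sup>+\<^sup>1\<close>. Every scale thus
  contributes at least a fixed amount, and there are \<open>j\<close> of them
  (\<open>gagliardo_energy_ge_spherical_jump\<close>).
\<close>

section \<open>The kernel of a bounded Lipschitz increment\<close>


text \<open>
  With \<open>q = s p\<close> this is the Gagliardo integrand of a map whose increment over a displacement
  \<open>z\<close> has norm exactly \<open>min 1 |z|\<close>, the extremal case of a map that is 1-Lipschitz and has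
  oscillation at most 1.
\<close>

definition truncated_kernel :: "real \<Rightarrow> real \<Rightarrow> 'a::euclidean_space \<Rightarrow> real" where
  "truncated_kernel p q z = min 1 (norm z) powr p / norm z powr (real DIM('a) + q)"

lemma truncated_kernel_nonneg: "0 \<le> truncated_kernel p q z"
  by (simp add: truncated_kernel_def)

lemma borel_measurable_truncated_kernel [measurable]:
  "truncated_kernel p q \<in> borel_measurable borel"
  unfolding truncated_kernel_def [abs_def] by measurable

lemma dyadic_bracket_ge_1:
  fixes r :: real
  assumes "1 \<le> r"
  obtains m :: nat where "2 powr m \<le> r" "r < 2 powr (m + 1)"
proof -
  define k where "k = \<lfloor>log 2 r\<rfloor>"
  have "0 \<le> k" using assms by (simp add: k_def)
  then obtain m where m: "k = int m" using nonneg_int_cases by blast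
  have "2 powr k \<le> r \<and> r < 2 powr (k + 1)"
    using assms by (subst floor_log_eq_powr_iff [symmetric]) (auto simp: k_def)
  then show ?thesis unfolding m by (intro that[of m]) (simp_all add: add.commute)
qed

lemma dyadic_bracket_less_1:
  fixes r :: real
  assumes "0 < r" "r < 1"
  obtains m :: nat where "2 powr - (real m + 1) \<le> r" "r < 2 powr - real m"
proof -
  define k where "k = \<lfloor>log 2 r\<rfloor>"
  have "k < 0" using assms by (simp add: k_def)
  then obtain m where m: "k = - int m - 1"
    by (intro that[of "nat (- k - 1)"]) simp
  have "2 powr k \<le> r \<and> r < 2 powr (k + 1)"
    using assms by (subst floor_log_eq_powr_iff [symmetric]) (auto simp: k_def)
  then show ?thesis unfolding m by (intro that[of m]) simp_all
qed

lemma emeasure_ball_dyadic: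
  "emeasure lborel (ball (c::'a::euclidean_space) (2 powr t))
     = ennreal (unit_ball_vol DIM('a) * 2 powr (t * DIM('a)))"
  by (simp add: emeasure_ball powr_power mult.commute)

lemma ennreal_le_suminf:
  fixes f :: "nat \<Rightarrow> ennreal"
  shows "f m \<le> (\<Sum>m. f m)"
  using sum_le_suminf[of f "{m}"] by simp

text \<open>
  On the dyadic annulus that contains \<open>z\<close>, the numerator is estimated at the outer radius
  and the denominator at the inner one. The first series covers the unit ball, the second
  its complement; at the origin the kernel is \<open>0 / 0 = 0\<close>. Replacing annuli by balls only
  enlarges the right-hand side and makes its integral explicit.
\<close>

lemma truncated_kernel_le_dyadic_sum:
  fixes z :: "'a::euclidean_space"
  assumes "0 < p" "0 < q"
  shows "ennreal (truncated_kernel p q z)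
    \<le> (\<Sum>m. ennreal (2 powr (- (real m * p) + (real m + 1) * (real DIM('a) + q))) * indicator (ball 0 (2 powr - real m)) z)
      + (\<Sum>m. ennreal (2 powr (- real m * (real DIM('a) + q))) * indicator (ball 0 (2 powr (real m + 1))) z)"
    (is "_ \<le> (\<Sum>m. ?F m) + (\<Sum>m. ?G m)")
proof -
  define d where "d = real DIM('a) + q"
  have d: "d > 0" using assms by (simp add: d_def add_nonneg_pos)
  consider "z = 0" | "z \<noteq> 0" "norm z < 1" | "1 \<le> norm z" by linarith
  then show ?thesis
  proof cases
    case 1
    then show ?thesis by (simp add: truncated_kernel_def)
  next
    case 2
    then have "0 < norm z" by simp
    from dyadic_bracket_less_1[OF this 2(2)] obtain m :: nat
      where m: "2 powr - (real m + 1) \<le> norm z" "norm z < 2 powr - real m" .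
    have "truncated_kernel p q z = norm z powr p / norm z powr d"
      using 2 by (simp add: truncated_kernel_def d_def)
    also have "\<dots> \<le> (2 powr - real m) powr p / (2 powr - (real m + 1)) powr d"
      using m assms d by (intro frac_le powr_mono2) auto
    also have "\<dots> = 2 powr (- (real m * p) + (real m + 1) * d)"
      unfolding powr_powr powr_diff [symmetric]
      by (rule arg_cong[where f="(powr) 2"]) (simp add: algebra_simps)
    finally have "ennreal (truncated_kernel p q z) \<le> ?F m"
      using m by (simp add: d_def ennreal_leI)
    also have "\<dots> \<le> (\<Sum>m. ?F m)"
      by (rule ennreal_le_suminf)
    also have "\<dots> \<le> (\<Sum>m. ?F m) + (\<Sum>m. ?G m)"
      by (rule add_increasing2) (rule zero_le order_refl)+
    finally show ?thesis .
  next
    case 3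
    from dyadic_bracket_ge_1[OF this] obtain m :: nat
      where m: "2 powr m \<le> norm z" "norm z < 2 powr (m + 1)" .
    have "truncated_kernel p q z = 1 / norm z powr d"
      using 3 by (simp add: truncated_kernel_def d_def)
    also have "\<dots> \<le> 1 / (2 powr m) powr d"
      using m assms d by (intro frac_le powr_mono2) auto
    also have "\<dots> = 2 powr (- real m * d)"
      by (simp only: powr_powr mult_minus_left powr_minus_divide)
    finally have "ennreal (truncated_kernel p q z) \<le> ?G m"
      using m by (simp add: d_def ennreal_leI add.commute)
    also have "\<dots> \<le> (\<Sum>m. ?G m)"
      by (rule ennreal_le_suminf)
    also have "\<dots> \<le> (\<Sum>m. ?F m) + (\<Sum>m. ?G m)"
      by (rule add_increasing) (rule zero_le order_refl)+
    finally show ?thesis .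
  qed
qed

lemma suminf_ennreal_powr_less_top:
  assumes "0 < c" "0 \<le> C"
  shows "(\<Sum>m. ennreal (C * 2 powr (- c * real m))) < \<infinity>"
proof -
  have "2 powr (- c) < (1::real)"
    using assms powr_less_mono[of "- c" 0 2] by simp
  then have "summable (\<lambda>m. C * (2 powr (- c)) ^ m)"
    by (intro summable_mult summable_geometric) simp
  then have "summable (\<lambda>m. C * 2 powr (- c * real m))"
    by (simp add: powr_power mult.commute)
  then have "(\<Sum>m. ennreal (C * 2 powr (- c * real m))) = ennreal (\<Sum>m. C * 2 powr (- c * real m))"
    using assms by (intro suminf_ennreal2) auto
  also have "\<dots> < \<infinity>" by (simp only: infinity_ennreal_def ennreal_less_top)
  finally show ?thesis .
qed

lemma nn_integral_two_suminf_indicators: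
  fixes a b :: "nat \<Rightarrow> ennreal"
  assumes [measurable]: "\<And>m. A m \<in> sets M" "\<And>m. B m \<in> sets M"
  shows "(\<integral>\<^sup>+ z. (\<Sum>m. a m * indicator (A m) z) + (\<Sum>m. b m * indicator (B m) z) \<partial>M)
    = (\<Sum>m. a m * emeasure M (A m)) + (\<Sum>m. b m * emeasure M (B m))"
  by (simp add: nn_integral_add nn_integral_suminf nn_integral_cmult)

text \<open>
  After multiplication by the volumes of the balls, the two dyadic series become geometric with
  ratios \<open>2 powr - (p - q)\<close> and \<open>2 powr - q\<close>: the singularity at the origin is integrable
  because \<open>q < p\<close>, and the tail because \<open>q > 0\<close>.
\<close>

lemma nn_integral_truncated_kernel_finite:
  assumes "0 < q" "q < p"
  shows "(\<integral>\<^sup>+ z. truncated_kernel p q (z::'a::euclidean_space) \<partial>lborel) < \<infinity>"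
proof -
  define n where "n = real DIM('a)"
  define \<omega> where "\<omega> = unit_ball_vol n"
  have \<omega>: "\<omega> \<ge> 0" by (simp add: \<omega>_def n_def)
  have combine: "ennreal (2 powr a) * ennreal (\<omega> * 2 powr b) = ennreal (\<omega> * 2 powr c * 2 powr d)"
    if "a + b = c + d" for a b c d :: real
    using that by (simp add: ennreal_mult' [symmetric] mult.left_commute mult.assoc flip: powr_add)
  have "(\<integral>\<^sup>+ z. truncated_kernel p q (z::'a) \<partial>lborel)
     \<le> (\<integral>\<^sup>+ z. (\<Sum>m. ennreal (2 powr (- (real m * p) + (real m + 1) * (n + q))) * indicator (ball (0::'a) (2 powr - real m)) z)
      + (\<Sum>m. ennreal (2 powr (- real m * (n + q))) * indicator (ball 0 (2 powr (real m + 1))) z) \<partial>lborel)"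
    using assms unfolding n_def
    by (intro nn_integral_mono truncated_kernel_le_dyadic_sum) auto
  also have "\<dots> = (\<Sum>m. ennreal (2 powr (- (real m * p) + (real m + 1) * (n + q))) * emeasure lborel (ball (0::'a) (2 powr - real m)))
      + (\<Sum>m. ennreal (2 powr (- real m * (n + q))) * emeasure lborel (ball (0::'a) (2 powr (real m + 1))))"
    by (rule nn_integral_two_suminf_indicators) simp_all
  also have "\<dots> = (\<Sum>m. ennreal ((\<omega> * 2 powr (n + q)) * 2 powr (- (p - q) * real m)))
      + (\<Sum>m. ennreal ((\<omega> * 2 powr n) * 2 powr (- q * real m)))"
    unfolding emeasure_ball_dyadic n_def [symmetric] \<omega>_def [symmetric]
    by (rule arg_cong2[where f="(+)"]; rule suminf_cong, rule combine) (simp_all add: algebra_simps)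
  also have "\<dots> < \<infinity>"
    unfolding infinity_ennreal_def ennreal_add_less_top
    by (intro conjI suminf_ennreal_powr_less_top[unfolded infinity_ennreal_def] mult_nonneg_nonneg \<omega>)
       (use assms in simp_all)
  finally show ?thesis .
qed

lemma nn_integral_lborel_affine:
  fixes h :: "'a::euclidean_space \<Rightarrow> ennreal"
  assumes [measurable]: "h \<in> borel_measurable borel" and "K \<noteq> 0"
  shows "(\<integral>\<^sup>+ z. h z \<partial>lborel) = ennreal (\<bar>K\<bar> ^ DIM('a)) * (\<integral>\<^sup>+ y. h (t + K *\<^sub>R y) \<partial>lborel)"
  by (subst lborel_affine[OF assms(2), of t])
     (simp add: nn_integral_density nn_integral_distr nn_integral_cmult)

section \<open>Maps that are constant outside a layer\<close>

lemma gagliardo_energy_lborel: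
  fixes v :: "'a::euclidean_space \<Rightarrow> 'b::euclidean_space"
  shows "gagliardo_energy s p \<Omega> v = (\<integral>\<^sup>+ z. (case z of (x, y) \<Rightarrow>
           ennreal (norm (v y - v x) powr p / norm (y - x) powr (real DIM('a) + s * p))) * indicator (\<Omega> \<times> \<Omega>) z \<partial>(lborel \<Otimes>\<^sub>M lborel))"
  by (simp only: gagliardo_energy_def nn_integral_completion lborel_prod)

lemma truncated_kernel_scale:
  fixes h :: "'a::euclidean_space"
  assumes "0 < K"
  shows "min 1 (K * norm h) powr p / norm h powr (real DIM('a) + q) = K powr (real DIM('a) + q) * truncated_kernel p q (K *\<^sub>R h)"
  using assms by (simp add: truncated_kernel_def powr_mult)

text \<open>
  The substitution \<open>z = K (y - x)\<close>: of the factor \<open>K powr (n + q)\<close> coming from the kernel, the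
  Jacobian takes away \<open>K ^ n\<close>.
\<close>

lemma nn_integral_truncated_kernel_translate:
  fixes x :: "'a::euclidean_space"
  assumes "0 < K"
  shows "(\<integral>\<^sup>+ y. ennreal (min 1 (K * norm (y - x)) powr p / norm (y - x) powr (real DIM('a) + q)) \<partial>lborel)
    = ennreal (K powr q) * (\<integral>\<^sup>+ z. truncated_kernel p q (z::'a) \<partial>lborel)"
proof -
  have "(\<integral>\<^sup>+ y. ennreal (min 1 (K * norm (y - x)) powr p / norm (y - x) powr (real DIM('a) + q)) \<partial>lborel)
    = ennreal (K powr (real DIM('a) + q)) * (\<integral>\<^sup>+ y. ennreal (truncated_kernel p q (- K *\<^sub>R x + K *\<^sub>R y)) \<partial>lborel)"
    unfolding truncated_kernel_scale[OF assms]
    by (simp add: ennreal_mult' scaleR_right_diff_distrib nn_integral_cmult truncated_kernel_nonneg)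
  also have "\<dots> = ennreal (K powr q) * (ennreal (\<bar>K\<bar> ^ DIM('a)) * (\<integral>\<^sup>+ y. ennreal (truncated_kernel p q (- K *\<^sub>R x + K *\<^sub>R y)) \<partial>lborel))"
    using assms by (simp add: powr_add powr_realpow ennreal_mult' mult_ac)
  also have "\<dots> = ennreal (K powr q) * (\<integral>\<^sup>+ z. truncated_kernel p q (z::'a) \<partial>lborel)"
    using assms by (subst nn_integral_lborel_affine[of "\<lambda>z. ennreal (truncated_kernel p q (z::'a))" K "- K *\<^sub>R x"]) auto
  finally show ?thesis .
qed

text \<open>
  A pair of points outside \<open>D\<close> contributes nothing, so the energy is at most twice the integral
  over the pairs whose first point lies in \<open>D\<close>. There the integrand is dominated by a rescaled
  truncated kernel, whose integral does not depend on the first point.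
\<close>

lemma gagliardo_energy_le_transition_layer:
  fixes g :: "'a::euclidean_space \<Rightarrow> 'b::euclidean_space"
  assumes "0 < p" "0 < K" "0 \<le> A"
    and D [measurable]: "D \<in> sets borel"
    and g: "\<And>x y. norm (g y - g x) \<le> A * min 1 (K * norm (y - x))"
    and off: "\<And>x. x \<notin> D \<Longrightarrow> g x = c"
  shows "gagliardo_energy s p \<Omega> g
    \<le> 2 * ennreal (A powr p * K powr (s * p)) * emeasure lborel D * (\<integral>\<^sup>+ z. truncated_kernel p (s * p) (z::'a) \<partial>lborel)"
proof -
  define N where "N = real DIM('a) + s * p"
  define k where "k x y = ennreal (min 1 (K * norm (y - x)) powr p / norm (y - x) powr N)" for x y :: 'a
  define W where "W = (\<integral>\<^sup>+ z. truncated_kernel p (s * p) (z::'a) \<partial>lborel)"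
  have k_commute: "k x y = k y x" for x y by (simp add: k_def norm_minus_commute)
  have k_meas [measurable]: "case_prod k \<in> borel_measurable (lborel \<Otimes>\<^sub>M lborel)"
    unfolding k_def case_prod_unfold by measurable
  have k_meas' [measurable]: "(\<lambda>z. k (fst z) (snd z)) \<in> borel_measurable (lborel \<Otimes>\<^sub>M lborel)"
    using k_meas by (simp add: case_prod_unfold)
  have kx_meas [measurable]: "k x \<in> borel_measurable lborel" for x
    unfolding k_def by measurable
  have int_k: "(\<integral>\<^sup>+ y. k x y \<partial>lborel) = ennreal (K powr (s * p)) * W" for x
    unfolding k_def N_def W_def by (rule nn_integral_truncated_kernel_translate) fact
  have first: "(\<integral>\<^sup>+ (x, y). indicator D x * k x y \<partial>(lborel \<Otimes>\<^sub>M lborel)) = emeasure lborel D * (ennreal (K powr (s * p)) * W)"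
  proof -
    have "(\<integral>\<^sup>+ (x, y). indicator D x * k x y \<partial>(lborel \<Otimes>\<^sub>M lborel)) = (\<integral>\<^sup>+ x. \<integral>\<^sup>+ y. indicator D x * k x y \<partial>lborel \<partial>lborel)"
      by (subst lborel.nn_integral_fst [symmetric]) (simp_all add: case_prod_unfold)
    also have "\<dots> = (\<integral>\<^sup>+ x. indicator D x * (ennreal (K powr (s * p)) * W) \<partial>lborel)"
      by (simp add: nn_integral_cmult int_k)
    also have "\<dots> = emeasure lborel D * (ennreal (K powr (s * p)) * W)"
      by (simp add: nn_integral_multc)
    finally show ?thesis .
  qed
  \<comment> \<open>By symmetry of the kernel, this is the first computation with the order of integration reversed.\<close>
  have second: "(\<integral>\<^sup>+ (x, y). indicator D y * k x y \<partial>(lborel \<Otimes>\<^sub>M lborel)) = emeasure lborel D * (ennreal (K powr (s * p)) * W)"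
  proof -
    have "(\<integral>\<^sup>+ (x, y). indicator D y * k x y \<partial>(lborel \<Otimes>\<^sub>M lborel)) = (\<integral>\<^sup>+ y. \<integral>\<^sup>+ x. indicator D y * k y x \<partial>lborel \<partial>lborel)"
      by (subst lborel_pair.nn_integral_snd [symmetric]) (simp_all add: case_prod_unfold k_commute)
    also have "\<dots> = (\<integral>\<^sup>+ y. indicator D y * (ennreal (K powr (s * p)) * W) \<partial>lborel)"
      by (simp add: nn_integral_cmult int_k)
    also have "\<dots> = emeasure lborel D * (ennreal (K powr (s * p)) * W)"
      by (simp add: nn_integral_multc)
    finally show ?thesis .
  qed
  have "gagliardo_energy s p \<Omega> g
    \<le> (\<integral>\<^sup>+ z. ennreal (A powr p) * ((case z of (x, y) \<Rightarrow> indicator D x * k x y) + (case z of (x, y) \<Rightarrow> indicator D y * k x y)) \<partial>(lborel \<Otimes>\<^sub>M lborel))"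
    unfolding gagliardo_energy_lborel
  proof (intro nn_integral_mono, clarsimp simp flip: N_def)
    fix x y :: 'a
    show "ennreal (norm (g y - g x) powr p / norm (y - x) powr N) * indicator (\<Omega> \<times> \<Omega>) (x, y)
      \<le> ennreal (A powr p) * (indicator D x * k x y + indicator D y * k x y)"
    proof (cases "x \<in> D \<or> y \<in> D")
      case True
      have "norm (g y - g x) powr p / norm (y - x) powr N \<le> (A * min 1 (K * norm (y - x))) powr p / norm (y - x) powr N"
        using g assms by (intro divide_right_mono powr_mono2) auto
      also have "\<dots> = A powr p * (min 1 (K * norm (y - x)) powr p / norm (y - x) powr N)"
        using assms by (simp add: powr_mult)
      finally have "ennreal (norm (g y - g x) powr p / norm (y - x) powr N) \<le> ennreal (A powr p) * k x y"
        unfolding k_def by (simp add: ennreal_mult' [symmetric] ennreal_leI)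
      also have "\<dots> \<le> ennreal (A powr p) * (indicator D x * k x y + indicator D y * k x y)"
        using True by (intro mult_left_mono) (auto simp: indicator_def)
      finally show ?thesis by (auto simp: indicator_def)
    next
      case False
      then show ?thesis by (simp add: off)
    qed
  qed
  also have "\<dots> = ennreal (A powr p) * (emeasure lborel D * (ennreal (K powr (s * p)) * W) + emeasure lborel D * (ennreal (K powr (s * p)) * W))"
    by (subst nn_integral_cmult, measurable, subst nn_integral_add, measurable) (simp only: first second)
  also have "\<dots> = 2 * ennreal (A powr p * K powr (s * p)) * emeasure lborel D * W"
    by (simp only: ennreal_mult'[OF powr_ge_zero] mult_2 distrib_left distrib_right) (simp only: mult_ac)
  finally show ?thesis unfolding W_def .
qed


section \<open>Volumes of thin spherical shells\<close>

lemma emeasure_spherical_shell: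
  fixes c :: "'a::euclidean_space"
  assumes "0 \<le> t" "t \<le> r"
  shows "emeasure lborel (cball c r - cball c t) = ennreal (unit_ball_vol DIM('a) * (r ^ DIM('a) - t ^ DIM('a)))"
proof -
  have "emeasure lborel (cball c r - cball c t) = emeasure lborel (cball c r) - emeasure lborel (cball c t)"
    using assms by (intro emeasure_Diff) (auto simp: emeasure_cball)
  also have "\<dots> = ennreal (unit_ball_vol DIM('a) * r ^ DIM('a) - unit_ball_vol DIM('a) * t ^ DIM('a))"
    using assms by (simp add: emeasure_cball ennreal_minus)
  finally show ?thesis by (simp add: right_diff_distrib)
qed

lemma power_diff_ge:
  fixes r t :: real
  assumes "0 \<le> t" "t \<le> r" "0 < n"
  shows "(r - t) * t ^ (n - 1) \<le> r ^ n - t ^ n"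
proof -
  obtain m where n: "n = Suc m" using assms by (cases n) auto
  have "r * t ^ m \<le> r * r ^ m"
    using assms by (intro mult_left_mono power_mono) auto
  then show ?thesis by (simp add: n left_diff_distrib)
qed

lemma power_diff_le:
  fixes r t :: real
  assumes "0 \<le> t" "0 < r"
  shows "r ^ n - t ^ n \<le> real n * (r - t) / r * r ^ n"
proof -
  have "(1 + real n * (t / r - 1)) * r ^ n \<le> (1 + (t / r - 1)) ^ n * r ^ n"
    using assms by (intro mult_right_mono Bernoulli_inequality) auto
  also have "\<dots> = t ^ n"
    using assms by (simp add: power_divide)
  finally show ?thesis
    using assms by (simp add: field_simps)
qed

section \<open>Maps that jump near a sphere\<close>

lemma gagliardo_energy_iterated:
  fixes v :: "'a::euclidean_space \<Rightarrow> 'b::euclidean_space"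
  assumes [measurable]: "\<Omega> \<in> sets borel" "v \<in> borel_measurable borel"
  shows "gagliardo_energy s p \<Omega> v =
    (\<integral>\<^sup>+ x. \<integral>\<^sup>+ y. ennreal (norm (v y - v x) powr p / norm (y - x) powr (real DIM('a) + s * p)) * indicator (\<Omega> \<times> \<Omega>) (x, y) \<partial>lborel \<partial>lborel)"
  unfolding gagliardo_energy_lborel
  by (subst lborel.nn_integral_fst [symmetric]) (simp_all add: case_prod_unfold)

text \<open>
  Let \<open>r k = R / 2 ^ Suc k\<close>, and let \<open>S k\<close> be the shell of the points whose depth below the sphere of
  radius \<open>R\<close> lies between \<open>r k / 2\<close> and \<open>r k\<close>. From a point of \<open>S k\<close>, moving radially outwards
  by \<open>2 * r k\<close> leads to the centre of a ball of radius \<open>r k\<close> that lies entirely outside the sphere.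
  Up to constants, this ball contributes \<open>r k ^ n / r k ^ (n + 1)\<close> to the inner integral,
  which the volume of \<open>S k\<close>, of order \<open>r k\<close>, compensates. The shells with \<open>k < j\<close> lie in the region where
  \<open>v = b\<close>. The factor 4 in the hypothesis leaves room in \<open>\<Omega>\<close> for the outer balls.
\<close>

lemma gagliardo_energy_ge_spherical_jump:
  fixes v :: "'a::euclidean_space \<Rightarrow> 'b::euclidean_space"
  assumes "0 < R" "s * p = 1" and ball: "ball x0 (4 * R) \<subseteq> \<Omega>"
    and \<Omega>: "\<Omega> \<in> sets borel" and v: "v \<in> borel_measurable borel"
    and inner: "\<And>x. dist x0 x \<le> R - R / 2 ^ Suc j \<Longrightarrow> v x = b"
    and outer: "\<And>x. R \<le> dist x0 x \<Longrightarrow> v x = a"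
  shows "ennreal (real j * (norm (a - b) powr p * (unit_ball_vol DIM('a))\<^sup>2 * (R / 2) ^ (DIM('a) - 1) / (2 * 3 ^ Suc DIM('a))))
    \<le> gagliardo_energy s p \<Omega> v"
proof -
  define n where "n = DIM('a)"
  have n: "0 < n" by (simp add: n_def)
  define \<omega> where "\<omega> = unit_ball_vol n"
  have \<omega>: "0 \<le> \<omega>" by (simp add: \<omega>_def)
  define M where "M = norm (a - b) powr p"
  have M: "0 \<le> M" by (simp add: M_def)
  define r where "r k = R / 2 ^ Suc k" for k
  have r_pos: "0 < r k" and r_Suc: "r (Suc k) = r k / 2" for k
    using \<open>0 < R\<close> by (simp_all add: r_def)
  have r_anti: "r l \<le> r k" if "k \<le> l" for k l
    using that \<open>0 < R\<close> by (auto simp: r_def intro!: frac_le power_increasing)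
  have r_le: "r k \<le> R / 2" for k
    using r_anti[of 0 k] by (simp add: r_def)
  define S where "S k = cball x0 (R - r (Suc k)) - cball x0 (R - r k)" for k
  have S_iff: "x \<in> S k \<longleftrightarrow> R - r k < dist x0 x \<and> dist x0 x \<le> R - r (Suc k)" for x k
    by (auto simp: S_def)
  have S_sets [measurable]: "S k \<in> sets lborel" for k
    by (simp add: S_def)
  define c where "c k = M / (3 * r k) ^ Suc n * (\<omega> * r k ^ n)" for k
  have c: "0 \<le> c k" for k
    using r_pos[of k] M \<omega> by (simp add: c_def)
  let ?F = "\<lambda>x y. ennreal (norm (v y - v x) powr p / norm (y - x) powr (real DIM('a) + s * p)) * indicator (\<Omega> \<times> \<Omega>) (x, y)"
  have inner_integral: "ennreal (c k) \<le> (\<integral>\<^sup>+ y. ?F x y \<partial>lborel)" if "k < j" and x: "x \<in> S k" for k x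
  proof -
    \<comment> \<open>The point \<open>y0\<close> is the centre of the ball outside the sphere that \<open>x\<close> interacts with.\<close>
    define y0 where "y0 = x + (2 * r k / dist x0 x) *\<^sub>R (x - x0)"
    have d: "R - r k < dist x0 x" "dist x0 x \<le> R - r (Suc k)"
      using x by (auto simp: S_iff)
    have d_pos: "0 < dist x0 x" using d(1) r_le[of k] \<open>0 < R\<close> by linarith
    have vx: "v x = b"
      using d(2) r_anti[of "Suc k" j] \<open>k < j\<close> by (intro inner) (simp add: r_def)
    have dist_y0_x: "dist y0 x = 2 * r k"
      using d_pos r_pos[of k] by (simp add: y0_def dist_norm norm_minus_commute)
    have "y0 - x0 = (1 + 2 * r k / dist x0 x) *\<^sub>R (x - x0)"
      by (simp add: y0_def algebra_simps)
    then have "norm (y0 - x0) = \<bar>1 + 2 * r k / dist x0 x\<bar> * norm (x - x0)"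
      by (simp only: norm_scaleR)
    moreover have "0 \<le> 1 + 2 * r k / dist x0 x"
      using r_pos[of k] d_pos by simp
    ultimately have "dist x0 y0 = (1 + 2 * r k / dist x0 x) * dist x0 x"
      by (simp only: abs_of_nonneg dist_norm norm_minus_commute[of x0])
    then have dist_x0_y0: "dist x0 y0 = dist x0 x + 2 * r k"
      using d_pos by (simp add: field_simps)
    have "ennreal (M / (3 * r k) ^ Suc n) * indicator (ball y0 (r k)) y \<le> ?F x y" for y
    proof (cases "y \<in> ball y0 (r k)")
      case True
      then have "dist y0 y < r k" by simp
      have "R < dist x0 y"
        using dist_triangle[of x0 y0 y] \<open>dist y0 y < r k\<close> dist_x0_y0 d(1) by (simp add: dist_commute)
      then have vy: "v y = a" by (intro outer) simp
      have "dist y x < 3 * r k"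
        using dist_triangle[of y x y0] \<open>dist y0 y < r k\<close> dist_y0_x by (simp add: dist_commute)
      moreover have "x \<noteq> y" using \<open>R < dist x0 y\<close> d(2) r_pos[of "Suc k"] by auto
      ultimately have xy: "0 < norm (y - x)" "norm (y - x) \<le> 3 * r k"
        by (simp_all add: dist_norm)
      have "dist x0 x < 4 * R" using d(2) r_pos[of "Suc k"] \<open>0 < R\<close> by linarith
      moreover have "dist x0 y < 4 * R"
        using dist_triangle[of x0 y x] \<open>dist y x < 3 * r k\<close> d(2) r_pos[of "Suc k"] r_le[of k] \<open>0 < R\<close>
        by (simp add: dist_commute)
      ultimately have "x \<in> \<Omega>" "y \<in> \<Omega>" using ball by auto
      have "M / (3 * r k) ^ Suc n \<le> M / norm (y - x) ^ Suc n"
        using xy M r_pos[of k] by (intro divide_left_mono power_mono mult_pos_pos zero_less_power) auto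
      also have "\<dots> = norm (v y - v x) powr p / norm (y - x) powr (real DIM('a) + s * p)"
        using xy \<open>s * p = 1\<close> powr_realpow[of "norm (y - x)" "Suc n"]
        by (simp add: vx vy M_def n_def add.commute)
      finally show ?thesis
        using True \<open>x \<in> \<Omega>\<close> \<open>y \<in> \<Omega>\<close> by (simp add: ennreal_leI)
    qed simp
    then have "(\<integral>\<^sup>+ y. ennreal (M / (3 * r k) ^ Suc n) * indicator (ball y0 (r k)) y \<partial>lborel) \<le> (\<integral>\<^sup>+ y. ?F x y \<partial>lborel)"
      by (intro nn_integral_mono)
    moreover have "(\<integral>\<^sup>+ y. ennreal (M / (3 * r k) ^ Suc n) * indicator (ball y0 (r k)) y \<partial>lborel) = ennreal (c k)"
      using r_pos[of k] M
      by (subst nn_integral_cmult_indicator)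
         (simp_all add: emeasure_ball c_def n_def \<omega>_def flip: ennreal_mult')
    ultimately show ?thesis by simp
  qed
  have shell: "ennreal (M * \<omega>\<^sup>2 * (R / 2) ^ (n - 1) / (2 * 3 ^ Suc n)) \<le> ennreal (c k) * emeasure lborel (S k)" for k
  proof -
    \<comment> \<open>The inner radius of the shell is at least \<open>R / 2\<close>, which bounds its area from below independently of \<open>k\<close>.\<close>
    have "r k / 2 * (R / 2) ^ (n - 1) \<le> ((R - r (Suc k)) - (R - r k)) * (R - r k) ^ (n - 1)"
      using r_pos[of k] r_le[of k] \<open>0 < R\<close> by (intro mult_mono power_mono) (auto simp: r_Suc)
    also have "\<dots> \<le> (R - r (Suc k)) ^ n - (R - r k) ^ n"
      using r_pos[of k] r_le[of k] \<open>0 < R\<close> n by (intro power_diff_ge) (auto simp: r_Suc)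
    finally have vol: "r k / 2 * (R / 2) ^ (n - 1) \<le> (R - r (Suc k)) ^ n - (R - r k) ^ n" .
    have "M * \<omega>\<^sup>2 * (R / 2) ^ (n - 1) / (2 * 3 ^ Suc n) = c k * (\<omega> * (r k / 2 * (R / 2) ^ (n - 1)))"
      using r_pos[of k] by (simp add: c_def power_mult_distrib field_simps power2_eq_square)
    also have "\<dots> \<le> c k * (\<omega> * ((R - r (Suc k)) ^ n - (R - r k) ^ n))"
      using vol c \<omega> by (intro mult_left_mono) auto
    finally have "ennreal (M * \<omega>\<^sup>2 * (R / 2) ^ (n - 1) / (2 * 3 ^ Suc n)) \<le> ennreal (c k * (\<omega> * ((R - r (Suc k)) ^ n - (R - r k) ^ n)))"
      by (rule ennreal_leI)
    also have "\<dots> = ennreal (c k) * emeasure lborel (S k)"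
      using r_pos[of k] r_le[of k] \<open>0 < R\<close> c
      unfolding S_def by (subst emeasure_spherical_shell) (auto simp: r_Suc ennreal_mult' n_def \<omega>_def)
    finally show ?thesis .
  qed
  have "ennreal (real j * (M * \<omega>\<^sup>2 * (R / 2) ^ (n - 1) / (2 * 3 ^ Suc n))) = (\<Sum>k<j. ennreal (M * \<omega>\<^sup>2 * (R / 2) ^ (n - 1) / (2 * 3 ^ Suc n)))"
    by (simp only: sum_constant card_lessThan ennreal_of_nat_eq_real_of_nat ennreal_mult'[OF of_nat_0_le_iff])
  also have "\<dots> \<le> (\<Sum>k<j. ennreal (c k) * emeasure lborel (S k))"
    by (intro sum_mono shell)
  also have "\<dots> = (\<integral>\<^sup>+ x. (\<Sum>k<j. ennreal (c k) * indicator (S k) x) \<partial>lborel)"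
    by (subst nn_integral_sum) (simp_all add: nn_integral_cmult nn_integral_indicator[OF S_sets])
  also have "\<dots> \<le> (\<integral>\<^sup>+ x. \<integral>\<^sup>+ y. ?F x y \<partial>lborel \<partial>lborel)"
  proof (rule nn_integral_mono)
    fix x :: 'a
    show "(\<Sum>k<j. ennreal (c k) * indicator (S k) x) \<le> (\<integral>\<^sup>+ y. ?F x y \<partial>lborel)"
    proof (cases "\<exists>k<j. x \<in> S k")
      case True
      then obtain k where k: "k < j" "x \<in> S k" by blast
      \<comment> \<open>The shells are disjoint, so at most one term of the sum is nonzero.\<close>
      have other: "x \<notin> S l" if "l \<noteq> k" for l
        using that k(2) r_anti[of "Suc l" k] r_anti[of "Suc k" l] by (cases "l < k") (auto simp: S_iff)
      have "(\<Sum>l<j. ennreal (c l) * indicator (S l) x) = (\<Sum>l\<in>{k}. ennreal (c l) * indicator (S l) x)"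
        using k other by (intro sum.mono_neutral_right) auto
      also have "\<dots> = ennreal (c k)" using k by simp
      also have "\<dots> \<le> (\<integral>\<^sup>+ y. ?F x y \<partial>lborel)" by (rule inner_integral[OF k])
      finally show ?thesis .
    next
      case False
      then have "(\<Sum>k<j. ennreal (c k) * indicator (S k) x) = 0" by (intro sum.neutral) auto
      then show ?thesis by (simp only: zero_le)
    qed
  qed
  also have "\<dots> = gagliardo_energy s p \<Omega> v"
    using \<Omega> v by (rule gagliardo_energy_iterated [symmetric])
  finally show ?thesis by (simp only: M_def \<omega>_def n_def)
qed

section \<open>The radial cutoff\<close>

definition spherical_cutoff :: "'a::metric_space \<Rightarrow> real \<Rightarrow> real \<Rightarrow> 'a \<Rightarrow> real" where
  "spherical_cutoff c R \<delta> x = max 0 (min 1 ((R - dist c x) / \<delta>))"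

lemma spherical_cutoff_inner: "0 < \<delta> \<Longrightarrow> dist c x \<le> R - \<delta> \<Longrightarrow> spherical_cutoff c R \<delta> x = 1"
  by (simp add: spherical_cutoff_def field_simps)

lemma spherical_cutoff_outer: "0 < \<delta> \<Longrightarrow> R \<le> dist c x \<Longrightarrow> spherical_cutoff c R \<delta> x = 0"
  by (simp add: spherical_cutoff_def divide_nonpos_pos min.coboundedI2 max.absorb1)

lemma spherical_cutoff_diff_le:
  fixes c x y :: "'a::real_normed_vector"
  assumes "0 < \<delta>"
  shows "\<bar>spherical_cutoff c R \<delta> y - spherical_cutoff c R \<delta> x\<bar> \<le> min 1 (1 / \<delta> * norm (y - x))"
proof -
  have "\<bar>(R - dist c y) / \<delta> - (R - dist c x) / \<delta>\<bar> = \<bar>dist c x - dist c y\<bar> / \<delta>"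
    using assms by (simp flip: diff_divide_distrib)
  also have "\<dots> \<le> norm (y - x) / \<delta>"
    using assms dist_triangle[of c x y] dist_triangle[of c y x]
    by (intro divide_right_mono) (auto simp: dist_norm norm_minus_commute)
  finally show ?thesis
    unfolding spherical_cutoff_def by (auto simp: max_def min_def)
qed

lemma continuous_on_spherical_cutoff: "continuous_on A (spherical_cutoff c R \<delta>)"
  unfolding spherical_cutoff_def [abs_def] divide_inverse by (intro continuous_intros)

section \<open>Unbounded energy with bounded composed energy\<close>

theorem proposition4p2:
  fixes \<Omega> :: "(real ^ 'n) set"
    and f :: "real ^ 'm \<Rightarrow> real ^ 'l"
    and s p :: real
  assumes "open \<Omega>" and "\<Omega> \<noteq> {}"
    and "0 < s" and "s < 1" and "1 \<le> p"
    and "s * p = 1"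
    and "\<exists>L. L-lipschitz_on UNIV f"
    and "\<not> inj f"
  shows "\<exists>u :: nat \<Rightarrow> real ^ 'n \<Rightarrow> real ^ 'm.
           (\<forall>j. u j \<in> hom_frac_sobolev s p \<Omega>) \<and>
           (\<lambda>j. gagliardo_energy s p \<Omega> (u j)) \<longlonglongrightarrow> \<infinity> \<and>
           (SUP j. gagliardo_energy s p \<Omega> (f \<circ> u j)) < \<infinity>"
proof -
  obtain a b where ab: "a \<noteq> b" "f a = f b"
    using \<open>\<not> inj f\<close> by (auto simp: inj_def)
  obtain L where L: "L-lipschitz_on UNIV f" using assms by blast
  then have "0 \<le> L" by (rule lipschitz_on_nonneg)
  have "1 < p"
  proof (rule ccontr)
    assume "\<not> 1 < p"
    then have "s * p = s" using \<open>1 \<le> p\<close> by simp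
    then show False using \<open>s * p = 1\<close> \<open>s < 1\<close> by simp
  qed
  obtain x0 where "x0 \<in> \<Omega>" using \<open>\<Omega> \<noteq> {}\<close> by blast
  then obtain e where e: "0 < e" "ball x0 e \<subseteq> \<Omega>"
    using \<open>open \<Omega>\<close> open_contains_ball by blast
  \<comment> \<open>The outer balls of the lower bound have to fit into \<open>\<Omega>\<close>.\<close>
  define R where "R = e / 4"
  have R: "0 < R" "ball x0 (4 * R) \<subseteq> \<Omega>" using e by (simp_all add: R_def)
  define \<delta> where "\<delta> j = R / 2 ^ Suc j" for j
  have \<delta>: "0 < \<delta> j" for j using R by (simp add: \<delta>_def)
  have \<delta>_le: "\<delta> j \<le> R" for j
    using R power_increasing[of 0 "Suc j" "2::real"] by (simp add: \<delta>_def divide_le_eq)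
  define \<phi> where "\<phi> j = spherical_cutoff x0 R (\<delta> j)" for j
  define u where "u j x = a + \<phi> j x *\<^sub>R (b - a)" for j x
  have u_inner: "u j x = b" if "dist x0 x \<le> R - \<delta> j" for j x
    using that \<delta> by (simp add: u_def \<phi>_def spherical_cutoff_inner)
  have u_outer: "u j x = a" if "R \<le> dist x0 x" for j x
    using that \<delta> by (simp add: u_def \<phi>_def spherical_cutoff_outer)
  have u_diff: "norm (u j y - u j x) \<le> norm (b - a) * min 1 (1 / \<delta> j * norm (y - x))" for j x y
  proof -
    have "u j y - u j x = (\<phi> j y - \<phi> j x) *\<^sub>R (b - a)"
      by (simp add: u_def algebra_simps)
    then have "norm (u j y - u j x) = norm (b - a) * \<bar>\<phi> j y - \<phi> j x\<bar>"
      by (simp only: norm_scaleR mult.commute)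
    also have "\<dots> \<le> norm (b - a) * min 1 (1 / \<delta> j * norm (y - x))"
      unfolding \<phi>_def by (intro mult_left_mono spherical_cutoff_diff_le \<delta>) simp
    finally show ?thesis .
  qed
  have fu_diff: "norm ((f \<circ> u j) y - (f \<circ> u j) x) \<le> L * norm (b - a) * min 1 (1 / \<delta> j * norm (y - x))" for j x y
  proof -
    have "norm ((f \<circ> u j) y - (f \<circ> u j) x) \<le> L * norm (u j y - u j x)"
      using lipschitz_onD[OF L, of "u j y" "u j x"] by (simp add: dist_norm)
    also have "\<dots> \<le> L * (norm (b - a) * min 1 (1 / \<delta> j * norm (y - x)))"
      by (intro mult_left_mono u_diff \<open>0 \<le> L\<close>)
    finally show ?thesis by (simp only: mult.assoc)
  qed
  have u_cont: "continuous_on UNIV (u j)" for j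
    unfolding u_def [abs_def] \<phi>_def
    by (intro continuous_intros continuous_on_spherical_cutoff)
  have u_borel: "u j \<in> borel_measurable borel" for j
    by (rule borel_measurable_continuous_onI [OF u_cont])
  define W where "W = (\<integral>\<^sup>+ z. truncated_kernel p (s * p) (z :: real ^ 'n) \<partial>lborel)"
  have W: "W < \<infinity>"
    unfolding W_def using \<open>s * p = 1\<close> \<open>1 < p\<close> by (intro nn_integral_truncated_kernel_finite) auto
  \<comment> \<open>Outside the fixed ball of radius \<open>R\<close> the map is constant; the resulting bound is finite but grows with \<open>j\<close>.\<close>
  have sobolev: "u j \<in> hom_frac_sobolev s p \<Omega>" for j
  proof -
    have "gagliardo_energy s p \<Omega> (u j)
      \<le> 2 * ennreal (norm (b - a) powr p * (1 / \<delta> j) powr (s * p)) * emeasure lborel (cball x0 R) * W"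
      unfolding W_def using u_diff u_outer \<open>1 < p\<close> \<delta>[of j]
      by (intro gagliardo_energy_le_transition_layer[where c = a]) auto
    also have "\<dots> < \<infinity>"
      using W R by (simp add: emeasure_cball ennreal_mult_less_top)
    finally have "gagliardo_energy s p \<Omega> (u j) < \<infinity>" .
    moreover have "u j \<in> borel_measurable (lebesgue_on \<Omega>)"
      using u_borel by (intro measurable_restrict_space1 measurable_completion) simp
    ultimately show ?thesis by (simp add: hom_frac_sobolev_def)
  qed
  define C where "C = norm (a - b) powr p * (unit_ball_vol DIM(real ^ 'n))\<^sup>2 * (R / 2) ^ (DIM(real ^ 'n) - 1) / (2 * 3 ^ Suc DIM(real ^ 'n))"
  have "0 < C"
    unfolding C_def using ab R by (intro divide_pos_pos mult_pos_pos zero_less_power) simp_all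
  have lower: "ennreal (real j * C) \<le> gagliardo_energy s p \<Omega> (u j)" for j
    unfolding C_def using R \<open>s * p = 1\<close> \<open>open \<Omega>\<close> u_borel u_inner u_outer
    by (intro gagliardo_energy_ge_spherical_jump) (auto simp: \<delta>_def)
  have "(\<lambda>j. ennreal (real j * C)) \<longlonglongrightarrow> \<infinity>"
  proof -
    have "filterlim (\<lambda>j. real j * C) at_top sequentially"
      using \<open>0 < C\<close> by (intro filterlim_at_top_mult_tendsto_pos[OF tendsto_const] filterlim_real_sequentially)
    then show ?thesis by (simp only: infinity_ennreal_def ennreal_tendsto_top_eq_at_top)
  qed
  then have diverges: "(\<lambda>j. gagliardo_energy s p \<Omega> (u j)) \<longlonglongrightarrow> \<infinity>"
    by (rule tendsto_sandwich[OF _ _ _ tendsto_const, rotated 2]) (simp_all add: lower)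
  define B where "B = 2 * ennreal ((L * norm (b - a)) powr p * (unit_ball_vol DIM(real ^ 'n) * (real DIM(real ^ 'n) / R * R ^ DIM(real ^ 'n)))) * W"
  \<comment> \<open>The factor \<open>1 / \<delta> j\<close> of the layer estimate cancels the thickness \<open>\<delta> j\<close> of the layer.\<close>
  have upper: "gagliardo_energy s p \<Omega> (f \<circ> u j) \<le> B" for j
  proof -
    define D where "D = cball x0 R - cball x0 (R - \<delta> j)"
    define A where "A = (L * norm (b - a)) powr p"
    have "ennreal (A / \<delta> j) * emeasure lborel D
      = ennreal (A / \<delta> j * (unit_ball_vol DIM(real ^ 'n) * (R ^ DIM(real ^ 'n) - (R - \<delta> j) ^ DIM(real ^ 'n))))"
      unfolding D_def using \<delta>[of j] \<delta>_le[of j]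
      by (subst emeasure_spherical_shell) (simp_all add: A_def flip: ennreal_mult')
    also have "\<dots> \<le> ennreal (A * (unit_ball_vol DIM(real ^ 'n) * (real DIM(real ^ 'n) / R * R ^ DIM(real ^ 'n))))"
    proof (rule ennreal_leI)
      have "R ^ DIM(real ^ 'n) - (R - \<delta> j) ^ DIM(real ^ 'n) \<le> \<delta> j * (real DIM(real ^ 'n) / R * R ^ DIM(real ^ 'n))"
        using power_diff_le[of "R - \<delta> j" R "DIM(real ^ 'n)"] \<delta>_le[of j] R by (simp add: mult_ac)
      then have "A / \<delta> j * (unit_ball_vol DIM(real ^ 'n) * (R ^ DIM(real ^ 'n) - (R - \<delta> j) ^ DIM(real ^ 'n)))
        \<le> A / \<delta> j * (unit_ball_vol DIM(real ^ 'n) * (\<delta> j * (real DIM(real ^ 'n) / R * R ^ DIM(real ^ 'n))))"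
        using \<delta>[of j] by (intro mult_left_mono) (auto simp: A_def)
      also have "\<dots> = A * (unit_ball_vol DIM(real ^ 'n) * (real DIM(real ^ 'n) / R * R ^ DIM(real ^ 'n)))"
        using \<delta>[of j] by simp
      finally show "A / \<delta> j * (unit_ball_vol DIM(real ^ 'n) * (R ^ DIM(real ^ 'n) - (R - \<delta> j) ^ DIM(real ^ 'n)))
        \<le> A * (unit_ball_vol DIM(real ^ 'n) * (real DIM(real ^ 'n) / R * R ^ DIM(real ^ 'n)))" .
    qed
    finally have layer: "ennreal (A / \<delta> j) * emeasure lborel D
      \<le> ennreal (A * (unit_ball_vol DIM(real ^ 'n) * (real DIM(real ^ 'n) / R * R ^ DIM(real ^ 'n))))" .
    have "(f \<circ> u j) x = f a" if "x \<notin> D" for x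
      using that u_inner[of x j] u_outer[of x j] ab by (cases "dist x0 x \<le> R - \<delta> j") (auto simp: D_def)
    then have "gagliardo_energy s p \<Omega> (f \<circ> u j) \<le> 2 * ennreal (A * (1 / \<delta> j) powr (s * p)) * emeasure lborel D * W"
      unfolding W_def A_def using fu_diff \<open>1 < p\<close> \<delta>[of j] \<open>0 \<le> L\<close>
      by (intro gagliardo_energy_le_transition_layer[where c = "f a"]) (auto simp: D_def simp del: o_apply)
    also have "\<dots> = 2 * (ennreal (A / \<delta> j) * emeasure lborel D) * W"
      using \<open>s * p = 1\<close> \<delta>[of j] by (simp add: mult.assoc)
    also have "\<dots> \<le> B"
      unfolding B_def A_def [symmetric] by (intro mult_right_mono mult_left_mono layer) auto
    finally show ?thesis .
  qed
  have "(SUP j. gagliardo_energy s p \<Omega> (f \<circ> u j)) \<le> B"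
    by (intro SUP_least upper)
  also have "B < \<infinity>"
    using W by (simp add: B_def ennreal_mult_less_top)
  finally show ?thesis using sobolev diverges by blast
qed

end
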